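(* Let $A$ be a finite alphabet, let $X\in A^\omega$, and let $\mu$ be a positive Bernoulli measure over $A$. (i) If $X$ is $\mu$-normal and $\mathcal{G}$ is a probabilistic $\mu$-gambler, then almost surely the sequence $\mathrm{Capital}(\mathcal{G},X[0,n])$, $n\ge 0$, either is ultimately constant or decreases at an exponential rate. (ii) If $X$ is not $\mu$-normal, then there exists a probabilistic $\mu$-gambler $\mathcal{G}$ which almost surely wins against $X$ at an "infinitely often" exponential rate, i.e. almost surely $\limsup_{n\to\infty}\frac{\log \mathrm{Capital}(\mathcal{G},X[0,n])}{n}>0$.
   Context: Words and frequencies. $A^*$ is the set of finite words, $A^\omega$ the set of infinite sequences over $A$. Positions start at $0$; $X(i)$ is the $i$-th letter and $X[i,j]=X(i)X(i+1)\cdots X(j)$. For a word $u$ of length $k$ and a word $w$ of length $n\ge k$, $\mathrm{NbOcc}(u,w)=\#\{i : 0\le i\le n-k,\ w[i,i+k-1]=u\}$ and $\mathrm{Freq}(u,w)=\mathrm{NbOcc}(u,w)/(n-k+1)$. For $X\in A^\omega$, $\mathrm{Freq}(u,X)=\lim_{n\to\infty}\mathrm{Freq}(u,X[0,n])$ when this limit exists. Bernoulli measures. A positive Bernoulli measure is given by a function $\mu:A\to(0,1]$ with $\sum_{a\in A}\mu(a)=1$; for $w=a_0\cdots a_k$, $\mu(w)=\prod_{j=0}^k\mu(a_j)$. $X\in A^\omega$ is $\mu$-normal if $\mathrm{Freq}(w,X)$ exists and equals $\mu(w)$ for all $w\in A^*$. Probabilistic gamblers. A probabilistic $\mu$-gambler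 is a tuple $\mathcal{G}=(Q,A,q_I,\delta,\gamma)$ with $Q$ a finite set of states, $q_I\in Q$ the initial state, $\delta:Q\times A\to\Delta(Q)$ (where $\Delta(Q)$ is the set of probability distributions on $Q$), and $\gamma:Q\times A\to\mathbb{R}^{\ge 0}$ such that $\sum_{a\in A}\mu(a)\gamma(q,a)=1$ for every $q\in Q$. Its run on $X$ is the random sequence $q_0=q_I$, $q_{n+1}=\delta_{n+1}(q_n,X(n))$, where $\{\delta_n(r,b): n\in\mathbb{N}, r\in Q, b\in A\}$ is a family of independent $Q$-valued random variables, $\delta_n(r,b)$ having distribution $\delta(r,b)$. The capital is the random variable $\mathrm{Capital}(\mathcal{G},X[0,n])=\prod_{i=0}^{n}\gamma(q_i,X(i))$. Rates. A sequence $(c_n)$ of nonnegative reals decreases at an exponential rate if there is $\kappa>0$ with $c_n\le 2^{-\kappa n}$ for all sufficiently large $n$. Convention: $\log 0=-\infty$. *)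

theory Defs
  imports "HOL-Probability.Probability"
begin

definition nb_occ :: "'a list \<Rightarrow> 'a list \<Rightarrow> nat" where
  "nb_occ u w = card {i. i + length u \<le> length w \<and> take (length u) (drop i w) = u}"

text \<open>Only meaningful when \<open>length u \<le> length w\<close>; the limit below ignores the finitely many
  prefixes for which this fails.\<close>

definition freq :: "'a list \<Rightarrow> 'a list \<Rightarrow> real" where
  "freq u w = real (nb_occ u w) / real (length w - length u + 1)"

definition upto_pos :: "(nat \<Rightarrow> 'a) \<Rightarrow> nat \<Rightarrow> 'a list" where
  "upto_pos X n = map X [0..<Suc n]"

definition positive_bernoulli :: "('a::finite \<Rightarrow> real) \<Rightarrow> bool" where
  "positive_bernoulli \<mu> \<longleftrightarrow> (\<forall>a. 0 < \<mu> a \<and> \<mu> a \<le> 1) \<and> (\<Sum>a\<in>UNIV. \<mu> a) = 1"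

definition word_measure :: "('a \<Rightarrow> real) \<Rightarrow> 'a list \<Rightarrow> real" where
  "word_measure \<mu> w = prod_list (map \<mu> w)"

definition bernoulli_normal :: "('a \<Rightarrow> real) \<Rightarrow> (nat \<Rightarrow> 'a) \<Rightarrow> bool" where
  "bernoulli_normal \<mu> X \<longleftrightarrow> (\<forall>w. (\<lambda>n. freq w (upto_pos X n)) \<longlonglongrightarrow> word_measure \<mu> w)"

record ('q, 'a) gambler =
  states :: "'q set"
  init :: 'q
  trans :: "'q \<Rightarrow> 'a \<Rightarrow> 'q pmf"
  bet :: "'q \<Rightarrow> 'a \<Rightarrow> real"

definition prob_gambler :: "('a::finite \<Rightarrow> real) \<Rightarrow> ('q, 'a) gambler \<Rightarrow> bool" where
  "prob_gambler \<mu> G \<longleftrightarrow>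
     finite (states G) \<and> init G \<in> states G \<and>
     (\<forall>q\<in>states G. \<forall>a. set_pmf (trans G q a) \<subseteq> states G) \<and>
     (\<forall>q\<in>states G. \<forall>a. 0 \<le> bet G q a) \<and>
     (\<forall>q\<in>states G. (\<Sum>a\<in>UNIV. \<mu> a * bet G q a) = 1)"

text \<open>Canonical realisation of the independent random transitions: the random variable
  \<open>\<delta>\<^sub>n(r,b)\<close> is the coordinate \<open>\<lambda>\<omega>. \<omega> (n, r, b)\<close> on the product space. The two lemmas confirm
  that the coordinates have the prescribed laws and are independent.\<close>

definition choice_space :: "('q, 'a) gambler \<Rightarrow> (nat \<times> 'q \<times> 'a \<Rightarrow> 'q) measure" where
  "choice_space G = PiM (UNIV \<times> states G \<times> UNIV) (\<lambda>(n, r, b). measure_pmf (trans G r b))"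

lemma prob_space_choice_space: "prob_space (choice_space G)"
  unfolding choice_space_def
  by (rule prob_space_PiM) (auto simp: measure_pmf.prob_space_axioms split: prod.splits)

lemma distr_choice_space:
  assumes "r \<in> states G"
  shows "distr (choice_space G) (count_space UNIV) (\<lambda>\<omega>. \<omega> (n, r, b)) = measure_pmf (trans G r b)"
proof -
  let ?I = "(UNIV :: nat set) \<times> states G \<times> (UNIV :: 'b set)"
  let ?M = "\<lambda>(n::nat, r, b). measure_pmf (trans G r b)"
  have "distr (PiM ?I ?M) (?M (n, r, b)) (\<lambda>\<omega>. \<omega> (n, r, b)) = ?M (n, r, b)"
    by (rule distr_PiM_component)
       (use assms in \<open>auto simp: measure_pmf.prob_space_axioms split: prod.splits\<close>)
  moreover have "distr (PiM ?I ?M) (?M (n, r, b)) (\<lambda>\<omega>. \<omega> (n, r, b)) =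
      distr (PiM ?I ?M) (count_space UNIV) (\<lambda>\<omega>. \<omega> (n, r, b))"
    by (rule distr_cong) auto
  ultimately show ?thesis
    by (simp add: choice_space_def)
qed

lemma indep_vars_choice_space:
  assumes "states G \<noteq> {}"
  shows "prob_space.indep_vars (choice_space G) (\<lambda>_. count_space UNIV) (\<lambda>i \<omega>. \<omega> i)
           (UNIV \<times> states G \<times> UNIV)"
proof -
  let ?I = "(UNIV :: nat set) \<times> states G \<times> (UNIV :: 'b set)"
  let ?M = "\<lambda>(n::nat, r, b). measure_pmf (trans G r b)"
  let ?C = "\<lambda>_ :: nat \<times> 'a \<times> 'b. count_space (UNIV :: 'a set)"
  let ?P = "choice_space G"
  have sets_P: "sets ?P = sets (PiM ?I ?C)"
    unfolding choice_space_def by (intro sets_PiM_cong) (auto split: prod.splits)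
  have space_P: "space ?P = space (PiM ?I ?C)"
    using sets_P by (rule sets_eq_imp_space_eq)
  have rv: "(\<lambda>\<omega>. \<omega> i) \<in> measurable ?P (?C i)" if "i \<in> ?I" for i
  proof -
    have "(\<lambda>\<omega>. \<omega> i) \<in> measurable (PiM ?I ?C) (?C i)"
      using that by (rule measurable_component_singleton)
    then show ?thesis
      using measurable_cong_sets[OF sets_P refl] by blast
  qed
  have "distr ?P (PiM ?I ?C) (\<lambda>\<omega>. \<lambda>i\<in>?I. \<omega> i) = distr ?P ?P (\<lambda>\<omega>. \<omega>)"
    by (rule distr_cong) (auto simp: sets_P space_P space_PiM PiE_restrict)
  also have "\<dots> = ?P"
    by (rule distr_id)
  also have "\<dots> = PiM ?I (\<lambda>i. distr ?P (?C i) (\<lambda>\<omega>. \<omega> i))"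
    by (subst (1) choice_space_def, rule PiM_cong) (auto simp: distr_choice_space)
  finally show ?thesis
    using assms rv
    by (subst prob_space.indep_vars_iff_distr_eq_PiM'[OF prob_space_choice_space]) auto
qed

primrec run :: "('q, 'a) gambler \<Rightarrow> (nat \<Rightarrow> 'a) \<Rightarrow> (nat \<times> 'q \<times> 'a \<Rightarrow> 'q) \<Rightarrow> nat \<Rightarrow> 'q" where
  "run G X \<omega> 0 = init G"
| "run G X \<omega> (Suc n) = \<omega> (Suc n, run G X \<omega> n, X n)"

text \<open>\<open>capital G X \<omega> n\<close> is the capital after the letters at positions \<open>0, \<dots>, n\<close>.\<close>

definition capital :: "('q, 'a) gambler \<Rightarrow> (nat \<Rightarrow> 'a) \<Rightarrow> (nat \<times> 'q \<times> 'a \<Rightarrow> 'q) \<Rightarrow> nat \<Rightarrow> real" where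
  "capital G X \<omega> n = (\<Prod>i=0..n. bet G (run G X \<omega> i) (X i))"

definition ultimately_constant :: "(nat \<Rightarrow> 'a) \<Rightarrow> bool" where
  "ultimately_constant c \<longleftrightarrow> (\<exists>x. \<forall>\<^sub>F n in sequentially. c n = x)"

definition decreases_exponentially :: "(nat \<Rightarrow> real) \<Rightarrow> bool" where
  "decreases_exponentially c \<longleftrightarrow>
     (\<exists>\<kappa>>0. \<forall>\<^sub>F n in sequentially. c n \<le> 2 powr (- \<kappa> * real n))"

text \<open>Base-2 logarithm of a nonnegative real with the convention \<open>log 0 = -\<infinity>\<close>.\<close>

definition elog :: "real \<Rightarrow> ereal" where
  "elog c = (if c = 0 then -\<infinity> else ereal (log 2 c))"

end

theory Submission
  imports Defs
begin

text \<open>For (i), call a state constant if the expected square root of the capital from it on random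
  letters stays \<open>1\<close>; by strict concavity such a state bets \<open>1\<close> on every letter, and runs cannot
  leave the set of these states. From every other state the expectation eventually drops below \<open>1\<close>,
  so the conditional expectation given the letters, restricted to runs avoiding the constant states,
  is submultiplicative with mean below \<open>1\<close> on long random words. Since \<open>x \<le> exp (x - 1)\<close>, normality
  of \<open>X\<close> turns this into exponential decay along \<open>X\<close>, and summability of the normalised
  expectations gives the almost sure statement.

  For (ii), take \<open>v a\<close> with the frequency of \<open>v\<close> correct and that of \<open>v a\<close> incorrect. The
  deterministic gambler that remembers the last letters and, after \<open>v\<close>, bets
  \<open>1 + t (1\<^bsub>b = a\<^esub> - \<mu> a)\<close> gains of order \<open>t\<close> times the deviation infinitely often and loses
  only of order \<open>t\<^sup>2\<close>.\<close>

subsection \<open>Window averages along normal sequences\<close>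

definition window :: "(nat \<Rightarrow> 'a) \<Rightarrow> nat \<Rightarrow> nat \<Rightarrow> 'a list" where
  "window X i k = map X [i..<i + k]"

lemma length_window [simp]: "length (window X i k) = k"
  by (simp add: window_def)

lemma window_append: "window X i (k + l) = window X i k @ window X (i + k) l"
proof -
  have "[i..<i + (k + l)] = [i..<i + k] @ [i + k..<i + k + l]"
    by (metis add.assoc le_add1 upt_add_eq_append)
  then show ?thesis by (simp add: window_def)
qed

text \<open>\<open>Suc (Suc n) - length u\<close> counts the possible starting positions in a prefix
  of \<open>Suc n\<close> letters; truncated subtraction gives \<open>0\<close> when
  \<open>u\<close> does not fit.\<close>

lemma nb_occ_upto_pos:
  "real (nb_occ u (upto_pos X n)) =
     (\<Sum>i<Suc (Suc n) - length u. of_bool (window X i (length u) = u))"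
proof -
  have "{i. i + length u \<le> length (upto_pos X n) \<and> take (length u) (drop i (upto_pos X n)) = u} =
        {i \<in> {..<Suc (Suc n) - length u}. window X i (length u) = u}"
  proof (intro set_eqI iffI; clarsimp simp del: upt_Suc simp: upto_pos_def)
    fix i assume *: "i + length u \<le> Suc n"
      "take (length u) (drop i (map X [0..<Suc n])) = u"
    then show "i < Suc (Suc n) - length u \<and> window X i (length u) = u"
      by (simp del: upt_Suc add: window_def take_map drop_map)
  next
    fix i assume *: "i < Suc (Suc n) - length u" "window X i (length u) = u"
    then show "i + length u \<le> Suc n \<and> take (length u) (drop i (map X [0..<Suc n])) = u"
      by (simp del: upt_Suc add: window_def take_map drop_map)
  qed
  then show ?thesis
    by (simp only: nb_occ_def sum_of_bool_eq finite_lessThan Int_def mem_Collect_eq)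
qed

lemma freq_upto_pos:
  "freq u (upto_pos X n) =
     (\<Sum>i<Suc (Suc n) - length u. of_bool (window X i (length u) = u)) / real (Suc n - length u + 1)"
  unfolding freq_def nb_occ_upto_pos by (simp add: upto_pos_def)

lemma finite_lists_of_length: "finite {w :: 'a::finite list. length w = n}"
  using finite_lists_length_eq[of "UNIV :: 'a set" n] by simp

lemma sum_lists_Suc:
  assumes "finite S"
  shows "(\<Sum>xs | set xs \<subseteq> S \<and> length xs = Suc n. F xs) =
         (\<Sum>x\<in>S. \<Sum>xs | set xs \<subseteq> S \<and> length xs = n. F (x # xs))"
proof -
  have "(\<Sum>xs | set xs \<subseteq> S \<and> length xs = Suc n. F xs) =
        (\<Sum>(xs, x)\<in>{xs. set xs \<subseteq> S \<and> length xs = n} \<times> S. F (x # xs))"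
    unfolding lists_length_Suc_eq
    by (subst sum.reindex) (auto simp: inj_on_def case_prod_unfold)
  also have "\<dots> = (\<Sum>xs | set xs \<subseteq> S \<and> length xs = n. \<Sum>x\<in>S. F (x # xs))"
    by (rule sum.cartesian_product[symmetric])
  also have "\<dots> = (\<Sum>x\<in>S. \<Sum>xs | set xs \<subseteq> S \<and> length xs = n. F (x # xs))"
    by (rule sum.swap)
  finally show ?thesis .
qed

text \<open>Shifting the left sequence by \<open>length u\<close> and the right one by two gives the
  same sequence, so prefixes too short for \<open>u\<close> do not affect the limit.\<close>

lemma freq_tendsto_iff_window:
  "((\<lambda>n. freq u (upto_pos X n)) \<longlonglongrightarrow> l) \<longleftrightarrow>
   ((\<lambda>n. (\<Sum>i<n. of_bool (window X i (length u) = u)) / real n) \<longlonglongrightarrow> l)"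
  (is "(?f \<longlonglongrightarrow> l) \<longleftrightarrow> (?g \<longlonglongrightarrow> l)")
proof -
  have "(\<lambda>n. ?f (n + length u)) = (\<lambda>n. ?g (n + 2))"
    by (rule ext) (simp add: freq_upto_pos Suc_diff_le del: sum_of_bool_eq)
  then show ?thesis
    using LIMSEQ_ignore_initial_segment[of ?f l "length u"] LIMSEQ_offset[of ?f "length u" l]
      LIMSEQ_ignore_initial_segment[of ?g l 2] LIMSEQ_offset[of ?g 2 l] by argo
qed

text \<open>Over a finite alphabet \<open>h\<close> is a finite linear combination of indicators of
  words of length \<open>k\<close>, so convergence passes from single words to
  \<open>h\<close>.\<close>

lemma bernoulli_normal_window_average:
  fixes X :: "nat \<Rightarrow> 'a::finite"
  assumes "bernoulli_normal \<mu> X"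
  shows "(\<lambda>n. (\<Sum>i<n. h (window X i k)) / real n)
           \<longlonglongrightarrow> (\<Sum>w | length w = k. word_measure \<mu> w * h w)"
proof -
  let ?F = "\<lambda>w n. (\<Sum>i<n. of_bool (window X i k = w)) / real n"
  have h: "h (window X i k) = (\<Sum>w | length w = k. of_bool (window X i k = w) * h w)" for i
  proof -
    have "(\<Sum>w | length w = k. of_bool (window X i k = w) * h w) =
          (\<Sum>w | length w = k. if window X i k = w then h w else 0)"
      by (intro sum.cong) auto
    then show ?thesis by (simp add: sum.delta finite_lists_of_length)
  qed
  have "(\<lambda>n. \<Sum>w | length w = k. ?F w n * h w) \<longlonglongrightarrow> (\<Sum>w | length w = k. word_measure \<mu> w * h w)"
  proof (intro tendsto_sum tendsto_mult_right)
    fix w :: "'a list" assume "w \<in> {w. length w = k}"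
    then show "?F w \<longlonglongrightarrow> word_measure \<mu> w"
      using assms unfolding bernoulli_normal_def freq_tendsto_iff_window by blast
  qed
  moreover have "(\<Sum>w | length w = k. ?F w n * h w) = (\<Sum>i<n. h (window X i k)) / real n" for n
    unfolding h sum_divide_distrib sum_distrib_right by (subst sum.swap) simp
  ultimately show ?thesis by simp
qed

text \<open>Multiplying the submultiplicativity bounds for all \<open>k\<close> residues of the block decomposition
  turns aligned blocks into sliding windows, whose averages normality controls.\<close>

lemma submultiplicative_normal_decay:
  fixes N :: "'a::finite list \<Rightarrow> real"
  assumes normal: "bernoulli_normal \<mu> X"
    and nonneg: "\<And>w. 0 \<le> N w"
    and submult: "\<And>u w. N (u @ w) \<le> N u * N w"
    and k: "0 < k" "(\<Sum>w | length w = k. word_measure \<mu> w * N w) < 1"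
  shows "\<exists>\<theta> C. 0 < \<theta> \<and> \<theta> < 1 \<and> (\<forall>n. N (window X 0 n) \<le> C * \<theta> ^ n)"
proof -
  define P where "P n = N (window X 0 n)" for n
  define W where "W n = N (window X n k)" for n
  \<comment> \<open>One factor per residue modulo \<open>k\<close>: passing from \<open>Q n\<close>
    to \<open>Q (Suc n)\<close> trades \<open>P n\<close> for \<open>P (n + k)\<close>, which costs
    at most the factor \<open>W n\<close>.\<close>
  define Q where "Q n = (\<Prod>j<k. P (n + j))" for n
  define \<rho> where "\<rho> = (\<Sum>w | length w = k. word_measure \<mu> w * N w)"
  define B where "B = Max (N ` {w. length w < Suc k})"
  have finB: "finite {w :: 'a list. length w < Suc k}"
    using finite_lists_length_le[of "UNIV :: 'a set" k] by (simp add: less_Suc_eq_le)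
  have B: "N w \<le> B" if "length w \<le> k" for w
    unfolding B_def using that finB by (intro Max_ge) auto
  have B0: "0 \<le> B" using B[of "[]"] nonneg[of "[]"] by simp
  have P0: "0 \<le> P n" and W0: "0 \<le> W n" for n by (simp_all add: P_def W_def nonneg)
  have Padd: "P (n + j) \<le> P n * N (window X n j)" for n j
    unfolding P_def window_append using submult by simp
  have Q: "Q n \<le> Q 0 * (\<Prod>i<n. W i)" for n
  proof (induction n)
    case (Suc n)
    have "Q (Suc n) \<le> Q n * W n"
    \<comment> \<open>The exchange cancels \<open>P n\<close>; if \<open>P n\<close> vanishes, so
      does \<open>P (n + k)\<close>, a factor of \<open>Q (Suc n)\<close>.\<close>
    proof (cases "P n = 0")
      case True
      then have "P (n + k) = 0" using Padd[of n k] P0[of "n + k"] by simp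
      moreover obtain k' where "k = Suc k'" using k(1) by (cases k) auto
      ultimately have "Q (Suc n) = 0" by (simp add: Q_def)
      moreover have "0 \<le> Q n" by (simp add: Q_def prod_nonneg P0)
      ultimately show ?thesis using W0[of n] by simp
    next
      case False
      have "P n * Q (Suc n) = (\<Prod>j<Suc k. P (n + j))"
        unfolding Q_def by (subst prod.lessThan_Suc_shift) simp
      also have "\<dots> = Q n * P (n + k)" by (simp add: Q_def)
      also have "\<dots> \<le> Q n * (P n * W n)"
        using Padd[of n k] by (intro mult_left_mono) (auto simp: W_def Q_def prod_nonneg P0)
      finally have "P n * Q (Suc n) \<le> P n * (Q n * W n)" by (simp add: mult_ac)
      then show ?thesis using False P0[of n] by simp
    qed
    also have "\<dots> \<le> Q 0 * (\<Prod>i<n. W i) * W n"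
      by (intro mult_right_mono Suc W0)
    finally show ?case by (simp add: mult_ac)
  qed simp
  have Wexp: "(\<Prod>i<n. W i) \<le> exp ((\<Sum>i<n. W i) - real n)" for n
  proof -
    have "(\<Prod>i<n. W i) \<le> (\<Prod>i<n. exp (W i - 1))"
      using W0 exp_ge_add_one_self[of "W i - 1" for i] by (intro prod_mono) (auto simp: algebra_simps)
    also have "\<dots> = exp ((\<Sum>i<n. W i) - real n)"
      by (simp add: exp_sum[symmetric] sum_subtractf)
    finally show ?thesis .
  qed
  have avg: "(\<lambda>n. (\<Sum>i<n. W i) / real n) \<longlonglongrightarrow> \<rho>"
    unfolding W_def \<rho>_def by (rule bernoulli_normal_window_average[OF normal])
  obtain n0 where n0: "(\<Sum>i<n. W i) / real n < (1 + \<rho>) / 2" if "n \<ge> n0" for n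
    using order_tendstoD(2)[OF avg, of "(1 + \<rho>) / 2"] k(2)
    by (auto simp: eventually_sequentially \<rho>_def)
  \<comment> \<open>Half the gap to \<open>1\<close>: from \<open>Suc n0\<close> on the average of
    \<open>W\<close> is below \<open>1 - d\<close>, so the exponent in \<open>Wexp\<close> is at
    most \<open>- d * real n\<close>.\<close>
  define d where "d = (1 - \<rho>) / 2"
  have d: "d > 0" using k(2) by (simp add: d_def \<rho>_def)
  have Qd: "Q n \<le> Q 0 * exp (- d * real n)" if n: "n \<ge> Suc n0" for n
  proof -
    have "(\<Sum>i<n. W i) < (1 + \<rho>) / 2 * real n"
      using n0[of n] n by (simp add: field_simps)
    then have "(\<Sum>i<n. W i) - real n \<le> - d * real n"
      by (simp add: d_def field_simps)
    then have "exp ((\<Sum>i<n. W i) - real n) \<le> exp (- d * real n)" by simp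
    with Wexp[of n] have "(\<Prod>i<n. W i) \<le> exp (- d * real n)" by linarith
    then have "Q 0 * (\<Prod>i<n. W i) \<le> Q 0 * exp (- d * real n)"
      by (intro mult_left_mono) (auto simp: Q_def prod_nonneg P0)
    with Q[of n] show ?thesis by linarith
  qed
  \<comment> \<open>Each of the \<open>k\<close> factors of \<open>Q n\<close> bounds
    \<open>P (n + k)\<close> up to \<open>B\<close>, because at most \<open>k\<close> letters lie
    between; hence the \<open>k\<close>-th power.\<close>
  have PQ: "P (n + k) ^ k \<le> B ^ k * Q n" for n
  proof -
    have "P (n + k) \<le> B * P (n + j)" if "j < k" for j
    proof -
      have "P (n + k) = P (n + j + (k - j))" using that by simp
      also have "\<dots> \<le> P (n + j) * N (window X (n + j) (k - j))" by (rule Padd)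
      also have "\<dots> \<le> P (n + j) * B"
        by (intro mult_left_mono B P0) simp
      finally show ?thesis by (simp add: mult_ac)
    qed
    then have "(\<Prod>j<k. P (n + k)) \<le> (\<Prod>j<k. B * P (n + j))"
      using P0 by (intro prod_mono) auto
    then show ?thesis by (simp add: Q_def prod.distrib)
  qed
  \<comment> \<open>The \<open>k\<close>-th root undoes the power in \<open>PQ\<close>; dividing by
    \<open>\<theta> ^ k\<close> in \<open>C0\<close> makes up for the shift from
    \<open>n - k\<close> to \<open>n\<close>.\<close>
  define \<theta> where "\<theta> = exp (- d / real k)"
  have th: "0 < \<theta>" "\<theta> < 1" using d k(1) by (auto simp: \<theta>_def)
  define C0 where "C0 = root k (B ^ k * Q 0) / \<theta> ^ k"
  have large: "P n \<le> C0 * \<theta> ^ n" if n: "n \<ge> Suc n0 + k" for n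
  proof -
    define i where "i = n - k"
    have i: "n = i + k" "i \<ge> Suc n0" using n by (auto simp: i_def)
    have Q00: "0 \<le> B ^ k * Q 0" using B0 by (simp add: Q_def prod_nonneg P0)
    have "P (i + k) ^ k \<le> B ^ k * (Q 0 * exp (- d * real i))"
      using PQ[of i] mult_left_mono[OF Qd[OF i(2)], of "B ^ k"] B0 by fastforce
    also have "exp (- d * real i) = (\<theta> ^ i) ^ k"
      using k(1) by (simp add: \<theta>_def exp_of_nat_mult[symmetric] power_mult[symmetric])
    also have "B ^ k * (Q 0 * (\<theta> ^ i) ^ k) = (root k (B ^ k * Q 0) * \<theta> ^ i) ^ k"
      using Q00 k(1) by (simp add: power_mult_distrib real_root_pow_pos2)
    finally have "P (i + k) \<le> root k (B ^ k * Q 0) * \<theta> ^ i"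
      using th Q00 k(1) by (subst (asm) power_mono_iff) (auto simp: P0)
    also have "\<dots> = C0 * \<theta> ^ n"
      using th by (simp add: C0_def i power_add)
    finally show ?thesis by (simp add: i)
  qed
  \<comment> \<open>The maximum absorbs the finitely many lengths up to the threshold.\<close>
  define C where "C = max C0 (Max ((\<lambda>n. P n / \<theta> ^ n) ` {..Suc n0 + k}))"
  have "P n \<le> C * \<theta> ^ n" for n
  proof (cases "n \<ge> Suc n0 + k")
    case True
    have "C0 * \<theta> ^ n \<le> C * \<theta> ^ n" using th by (intro mult_right_mono) (auto simp: C_def)
    with large[OF True] show ?thesis by linarith
  next
    case False
    then have "P n / \<theta> ^ n \<le> Max ((\<lambda>n. P n / \<theta> ^ n) ` {..Suc n0 + k})" by (intro Max_ge) auto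
    also have "\<dots> \<le> C" by (simp add: C_def)
    finally show ?thesis using th by (simp add: field_simps)
  qed
  with th show ?thesis unfolding P_def by blast
qed

subsection \<open>Mean square-root capital\<close>

locale bernoulli_gambler =
  fixes \<mu> :: "'a::finite \<Rightarrow> real" and G :: "('q, 'a) gambler"
  assumes bernoulli: "positive_bernoulli \<mu>" and gambler: "prob_gambler \<mu> G"
begin

lemma \<mu>_pos: "0 < \<mu> a" and \<mu>_sum: "(\<Sum>a\<in>UNIV. \<mu> a) = 1"
  using bernoulli by (auto simp: positive_bernoulli_def)

lemma \<mu>_nonneg: "0 \<le> \<mu> a"
  using \<mu>_pos by (rule less_imp_le)

lemma finite_states: "finite (states G)" and init_states: "init G \<in> states G"
  using gambler by (auto simp: prob_gambler_def)

lemma trans_states: "q \<in> states G \<Longrightarrow> set_pmf (trans G q a) \<subseteq> states G"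
  and bet_nonneg: "q \<in> states G \<Longrightarrow> 0 \<le> bet G q a"
  and bet_mean: "q \<in> states G \<Longrightarrow> (\<Sum>a\<in>UNIV. \<mu> a * bet G q a) = 1"
  using gambler by (auto simp: prob_gambler_def)

lemma sum_pmf_trans: "q \<in> states G \<Longrightarrow> (\<Sum>r\<in>states G. pmf (trans G q a) r) = 1"
  by (rule sum_pmf_eq_1[OF finite_states trans_states])

text \<open>The deficit from \<open>1\<close> is half the mean of
  \<open>(1 - sqrt (bet G q a))\<^sup>2\<close>. In the case of equality, positivity of
  \<open>\<mu>\<close> forces every square to vanish.\<close>

lemma sum_sqrt_bet_le_1:
  assumes "q \<in> states G"
  shows "(\<Sum>a\<in>UNIV. \<mu> a * sqrt (bet G q a)) \<le> 1"
    and "(\<Sum>a\<in>UNIV. \<mu> a * sqrt (bet G q a)) = 1 \<Longrightarrow> bet G q b = 1"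
proof -
  have eq: "(\<Sum>a\<in>UNIV. \<mu> a * (1 - sqrt (bet G q a))\<^sup>2) =
      2 * (1 - (\<Sum>a\<in>UNIV. \<mu> a * sqrt (bet G q a)))"
  proof -
    have "\<mu> a * (1 - sqrt (bet G q a))\<^sup>2 = \<mu> a + \<mu> a * bet G q a - 2 * (\<mu> a * sqrt (bet G q a))" for a
      using bet_nonneg[OF assms, of a] by (simp add: power2_diff algebra_simps)
    then show ?thesis
      by (simp add: sum.distrib sum_subtractf sum_distrib_left[symmetric] \<mu>_sum bet_mean[OF assms])
  qed
  have nonneg: "0 \<le> \<mu> a * (1 - sqrt (bet G q a))\<^sup>2" for a
    by (simp add: \<mu>_nonneg)
  have "0 \<le> (\<Sum>a\<in>UNIV. \<mu> a * (1 - sqrt (bet G q a))\<^sup>2)"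
    by (intro sum_nonneg nonneg)
  then show "(\<Sum>a\<in>UNIV. \<mu> a * sqrt (bet G q a)) \<le> 1"
    unfolding eq by simp
  assume "(\<Sum>a\<in>UNIV. \<mu> a * sqrt (bet G q a)) = 1"
  then have "(\<Sum>a\<in>UNIV. \<mu> a * (1 - sqrt (bet G q a))\<^sup>2) = 0"
    unfolding eq by simp
  then have "\<forall>a\<in>UNIV. \<mu> a * (1 - sqrt (bet G q a))\<^sup>2 = 0"
    by (rule sum_nonneg_eq_0_iff[THEN iffD1, rotated 2]) (use nonneg in auto)
  then have "\<mu> b * (1 - sqrt (bet G q b))\<^sup>2 = 0" by blast
  then show "bet G q b = 1" using \<mu>_pos[of b] by simp
qed

text \<open>The transfer operator of the square-root capital; iterating it with a cut-off to
  \<open>S\<close> gives \<open>mean_weight\<close>.\<close>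

definition mean_step :: "('q \<Rightarrow> real) \<Rightarrow> 'q \<Rightarrow> real" where
  "mean_step F q = (\<Sum>a\<in>UNIV. \<mu> a * sqrt (bet G q a) * (\<Sum>r\<in>states G. pmf (trans G q a) r * F r))"

lemma mean_step_mono:
  assumes "q \<in> states G" "\<And>r. r \<in> states G \<Longrightarrow> F r \<le> H r"
  shows "mean_step F q \<le> mean_step H q"
  unfolding mean_step_def
  by (intro sum_mono mult_left_mono assms mult_nonneg_nonneg \<mu>_nonneg real_sqrt_ge_zero bet_nonneg) auto

lemma mean_step_scale: "mean_step (\<lambda>r. F r * c) q = mean_step F q * c"
  by (simp add: mean_step_def sum_distrib_right sum_distrib_left mult_ac)

lemma mean_step_one:
  assumes "q \<in> states G"
  shows "mean_step (\<lambda>_. 1) q = (\<Sum>a\<in>UNIV. \<mu> a * sqrt (bet G q a))"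
  by (simp add: mean_step_def sum_pmf_trans[OF assms])

text \<open>\<open>root_weight S w q\<close> is the expected square root of the capital after reading \<open>w\<close> from \<open>q\<close>,
  restricted to runs staying in \<open>S\<close>; \<open>mean_weight S n q\<close> averages it over random words \<open>w\<close> of
  length \<open>n\<close>.\<close>

primrec root_weight :: "'q set \<Rightarrow> 'a list \<Rightarrow> 'q \<Rightarrow> real" where
  "root_weight S [] q = indicator S q"
| "root_weight S (a # w) q =
     indicator S q * (sqrt (bet G q a) * (\<Sum>r\<in>states G. pmf (trans G q a) r * root_weight S w r))"

primrec mean_weight :: "'q set \<Rightarrow> nat \<Rightarrow> 'q \<Rightarrow> real" where
  "mean_weight S 0 q = indicator S q"
| "mean_weight S (Suc n) q = indicator S q * mean_step (mean_weight S n) q"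

lemma root_weight_nonneg: "q \<in> states G \<Longrightarrow> 0 \<le> root_weight S w q"
  by (induction w arbitrary: q) (auto intro!: mult_nonneg_nonneg sum_nonneg bet_nonneg)

text \<open>Splitting off the first letter turns the average over words into an iteration of
  \<open>mean_step\<close>.\<close>

lemma sum_root_weight:
  "(\<Sum>w | length w = n. word_measure \<mu> w * root_weight S w q) = mean_weight S n q"
proof (induction n arbitrary: q)
  case 0
  then show ?case by (simp add: word_measure_def)
next
  case (Suc n)
  have "(\<Sum>w | length w = Suc n. word_measure \<mu> w * root_weight S w q) =
    (\<Sum>a\<in>UNIV. \<Sum>w | length w = n. word_measure \<mu> (a # w) * root_weight S (a # w) q)"
    using sum_lists_Suc[of "UNIV :: 'a set" "\<lambda>w. word_measure \<mu> w * root_weight S w q" n]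
    by (simp del: root_weight.simps)
  also have "\<dots> = (\<Sum>a\<in>UNIV. indicator S q * (\<mu> a * sqrt (bet G q a) *
      (\<Sum>r\<in>states G. pmf (trans G q a) r * mean_weight S n r)))"
  proof (rule sum.cong[OF refl])
    fix a
    have "(\<Sum>r\<in>states G. pmf (trans G q a) r * mean_weight S n r) =
      (\<Sum>r\<in>states G. \<Sum>w | length w = n. pmf (trans G q a) r * (word_measure \<mu> w * root_weight S w r))"
      by (simp only: Suc.IH[symmetric] sum_distrib_left)
    also have "\<dots> =
      (\<Sum>w | length w = n. \<Sum>r\<in>states G. pmf (trans G q a) r * (word_measure \<mu> w * root_weight S w r))"
      by (rule sum.swap)
    finally have "(\<Sum>r\<in>states G. pmf (trans G q a) r * mean_weight S n r) =
      (\<Sum>w | length w = n. \<Sum>r\<in>states G. pmf (trans G q a) r * (word_measure \<mu> w * root_weight S w r))" .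
    then show "(\<Sum>w | length w = n. word_measure \<mu> (a # w) * root_weight S (a # w) q) =
      indicator S q * (\<mu> a * sqrt (bet G q a) *
      (\<Sum>r\<in>states G. pmf (trans G q a) r * mean_weight S n r))"
      by (simp add: word_measure_def sum_distrib_left mult_ac)
  qed
  also have "\<dots> = mean_weight S (Suc n) q"
    by (simp add: mean_step_def sum_distrib_left)
  finally show ?case .
qed

lemma word_measure_nonneg: "0 \<le> word_measure \<mu> w"
  by (induction w) (simp_all add: word_measure_def \<mu>_nonneg)

lemma mean_weight_nonneg: "q \<in> states G \<Longrightarrow> 0 \<le> mean_weight S n q"
  unfolding sum_root_weight[symmetric]
  by (intro sum_nonneg mult_nonneg_nonneg root_weight_nonneg word_measure_nonneg)

lemma mean_weight_le_1: "q \<in> states G \<Longrightarrow> mean_weight S n q \<le> 1"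
proof (induction n arbitrary: q)
  case (Suc n)
  have "mean_step (mean_weight S n) q \<le> mean_step (\<lambda>_. 1) q"
    by (intro mean_step_mono Suc)
  also have "\<dots> \<le> 1"
    using Suc.prems by (simp add: mean_step_one sum_sqrt_bet_le_1(1))
  finally show ?case by (simp add: indicator_def)
qed (simp add: indicator_def)

text \<open>The bound by \<open>1\<close> gives the first step, and monotonicity of
  \<open>mean_step\<close> carries it to all later ones.\<close>

lemma mean_weight_antimono:
  assumes "m \<le> n" "q \<in> states G"
  shows "mean_weight S n q \<le> mean_weight S m q"
proof -
  have step: "mean_weight S (Suc n) q \<le> mean_weight S n q" if "q \<in> states G" for n q
    using that
  proof (induction n arbitrary: q)
    case 0
    then show ?case
      using mean_weight_le_1[of q S "Suc 0"] by (cases "q \<in> S") auto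
  next
    case (Suc n)
    have "mean_step (mean_weight S (Suc n)) q \<le> mean_step (mean_weight S n) q"
      using Suc by (intro mean_step_mono) auto
    then show ?case
      by (subst (1 2) mean_weight.simps(2)) (simp add: indicator_def del: mean_weight.simps)
  qed
  show ?thesis
    by (rule lift_Suc_antimono_le[of "\<lambda>n. mean_weight S n q", OF step assms(1)]) (rule assms(2))
qed

lemma mean_weight_subset:
  assumes "S \<subseteq> T" "q \<in> states G"
  shows "mean_weight S n q \<le> mean_weight T n q"
  using assms(2)
proof (induction n arbitrary: q)
  case 0
  then show ?case using assms(1) by (auto simp: indicator_def)
next
  case (Suc n)
  have "mean_step (mean_weight S n) q \<le> mean_step (mean_weight T n) q"
    using Suc by (intro mean_step_mono) auto
  moreover have "0 \<le> mean_weight T (Suc n) q"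
    using Suc.prems by (rule mean_weight_nonneg)
  ultimately show ?case using assms(1) by (auto simp: indicator_def split: if_splits)
qed

text \<open>Monotonicity and homogeneity of \<open>mean_step\<close> let a uniform bound on the last
  \<open>k\<close> steps factor out.\<close>

lemma mean_weight_add_le:
  assumes "\<And>r. r \<in> states G \<Longrightarrow> mean_weight S k r \<le> c" "q \<in> states G"
  shows "mean_weight S (n + k) q \<le> mean_weight S n q * c"
  using assms(2)
proof (induction n arbitrary: q)
  case 0
  then show ?case using assms(1)[of q]
    by (cases "q \<in> S"; cases k) auto
next
  case (Suc n)
  have "mean_step (mean_weight S (n + k)) q \<le> mean_step (\<lambda>r. mean_weight S n r * c) q"
    using Suc by (intro mean_step_mono) auto
  then show ?case by (simp add: mean_step_scale indicator_def)
qed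

section \<open>Constant states, and contraction on the active states\<close>

definition constant_states :: "'q set" where
  "constant_states = {q \<in> states G. \<forall>n. mean_weight (states G) n q = 1}"

text \<open>Words of length one already give the equality case of
  \<open>sum_sqrt_bet_le_1\<close>.\<close>

lemma constant_states_bet:
  assumes "q \<in> constant_states"
  shows "bet G q a = 1"
proof -
  have q: "q \<in> states G" and "mean_weight (states G) (Suc 0) q = 1"
    using assms unfolding constant_states_def by blast+
  then have "mean_step (indicator (states G)) q = 1"
    by (simp add: mean_step_def)
  moreover have "mean_step (indicator (states G)) q = mean_step (\<lambda>_. 1) q"
    by (simp add: mean_step_def)
  ultimately show ?thesis
    using mean_step_one[OF q] sum_sqrt_bet_le_1(2)[OF q] by simp
qed

text \<open>All bets at \<open>q\<close> are \<open>1\<close>, so the mean weight at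
  \<open>q\<close> for \<open>Suc n\<close> averages the weights of the successors for
  \<open>n\<close>, each at most \<open>1\<close>. If the average is \<open>1\<close>, so is every
  term of positive probability. This is why \<open>constant_states\<close> asks for all
  \<open>n\<close>.\<close>

lemma constant_states_trans:
  assumes "q \<in> constant_states"
  shows "set_pmf (trans G q a) \<subseteq> constant_states"
proof
  fix r assume r: "r \<in> set_pmf (trans G q a)"
  have q: "q \<in> states G" using assms by (simp add: constant_states_def)
  have rs: "r \<in> states G" using r trans_states[OF q] by blast
  have "mean_weight (states G) n r = 1" for n
  proof -
    let ?h = "\<lambda>b s. \<mu> b * (pmf (trans G q b) s * (1 - mean_weight (states G) n s))"
    have "mean_weight (states G) (Suc n) q = 1"
      using assms unfolding constant_states_def by blast
    then have "mean_step (mean_weight (states G) n) q = 1" using q by simp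
    then have "(\<Sum>b\<in>UNIV. \<Sum>s\<in>states G. ?h b s) = 0"
      by (simp add: mean_step_def constant_states_bet[OF assms] right_diff_distrib sum_subtractf
          sum_distrib_left[symmetric] sum_pmf_trans[OF q] \<mu>_sum)
    moreover have nonneg: "0 \<le> ?h b s" if "s \<in> states G" for b s
      using mean_weight_le_1[OF that, of "states G" n] by (simp add: \<mu>_nonneg)
    ultimately have "(\<Sum>s\<in>states G. ?h a s) = 0"
      by (subst (asm) sum_nonneg_eq_0_iff) (auto intro!: sum_nonneg)
    then have "?h a r = 0"
      using rs finite_states nonneg by (subst (asm) sum_nonneg_eq_0_iff) auto
    then show ?thesis
      using \<mu>_pos[of a] pmf_positive[OF r] by simp
  qed
  then show "r \<in> constant_states" using rs by (simp add: constant_states_def)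
qed

abbreviation "active_states \<equiv> states G - constant_states"

text \<open>Finiteness of the state set makes the drop below \<open>1\<close> uniform after
  \<open>L\<close> steps. Iterating brings each weight below \<open>1 / card (states G)\<close>,
  hence the sum below \<open>1\<close>.\<close>

lemma mean_weight_active_contraction:
  "\<exists>k>0. (\<Sum>q\<in>states G. mean_weight active_states k q) < 1"
proof -
  have "\<exists>n. mean_weight (states G) n q < 1" if "q \<in> active_states" for q
  proof -
    from that obtain n where "q \<in> states G" "mean_weight (states G) n q \<noteq> 1"
      by (auto simp: constant_states_def)
    with mean_weight_le_1[of q "states G" n] show ?thesis by (auto simp: less_le)
  qed
  then obtain N where N: "mean_weight (states G) (N q) q < 1" if "q \<in> active_states" for q
    by metis
  \<comment> \<open>The sum dominates each \<open>N q\<close>, and \<open>Suc\<close> makes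
    \<open>L\<close> positive so that the final length \<open>k * L\<close> is positive.\<close>
  define L where "L = Suc (\<Sum>q\<in>active_states. N q)"
  have L: "mean_weight active_states L q < 1" if q: "q \<in> states G" for q
  proof (cases "q \<in> constant_states")
    case True
    then show ?thesis by (simp add: L_def)
  next
    case False
    with q have qa: "q \<in> active_states" by simp
    then have "N q \<le> (\<Sum>q\<in>active_states. N q)"
      using finite_states by (intro member_le_sum) auto
    then have "N q \<le> L" by (simp add: L_def)
    have "mean_weight active_states L q \<le> mean_weight (states G) L q"
      using q by (intro mean_weight_subset) auto
    also have "\<dots> \<le> mean_weight (states G) (N q) q"
      using \<open>N q \<le> L\<close> q by (rule mean_weight_antimono)
    also have "\<dots> < 1" using N[OF qa] .
    finally show ?thesis .
  qed
  define c where "c = Max (mean_weight active_states L ` states G)"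
  have ne: "states G \<noteq> {}" using init_states by blast
  have c: "c < 1" "\<And>q. q \<in> states G \<Longrightarrow> mean_weight active_states L q \<le> c"
    using L finite_states ne by (auto simp: c_def)
  have c0: "0 \<le> c"
    using c(2)[OF init_states] mean_weight_nonneg[OF init_states, of active_states L] by linarith
  have pow: "mean_weight active_states (k * L) q \<le> c ^ k" if "q \<in> states G" for k q
  proof (induction k)
    case 0
    then show ?case using that by (simp add: indicator_def)
  next
    case (Suc k)
    have "mean_weight active_states (k * L + L) q \<le> mean_weight active_states (k * L) q * c"
      using c(2) that by (rule mean_weight_add_le)
    also have "\<dots> \<le> c ^ k * c" using Suc c0 by (intro mult_right_mono)
    finally show ?case by (simp add: add.commute mult.commute)
  qed
  have card: "0 < card (states G)" using ne finite_states by (simp add: card_gt_0_iff)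
  obtain k where k: "c ^ k < 1 / card (states G)"
    using real_arch_pow_inv[of "1 / card (states G)" c] c card by auto
  have "k \<noteq> 0"
    using k card by (auto simp: field_simps intro!: Nat.gr0I)
  moreover have "(\<Sum>q\<in>states G. mean_weight active_states (k * L) q) \<le> (\<Sum>q\<in>states G. c ^ k)"
    by (intro sum_mono pow)
  moreover have "(\<Sum>q\<in>states G. c ^ k) < 1"
    using k card by (simp add: field_simps)
  ultimately show ?thesis
    by (intro exI[of _ "k * L"]) (simp add: L_def)
qed

text \<open>The state reached after \<open>u\<close> is random; summing over all states dominates
  every case. A further sum over \<open>q\<close> gives the submultiplicative weight used along
  \<open>X\<close>.\<close>

lemma root_weight_append_le:
  assumes "q \<in> states G"
  shows "root_weight S (u @ w) q \<le> root_weight S u q * (\<Sum>r\<in>states G. root_weight S w r)"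
  using assms
proof (induction u arbitrary: q)
  case Nil
  have "root_weight S w q \<le> (\<Sum>r\<in>states G. root_weight S w r)"
    using Nil finite_states by (intro member_le_sum root_weight_nonneg) auto
  moreover have "root_weight S w q = 0" if "q \<notin> S" using that by (cases w) auto
  ultimately show ?case by (auto simp: indicator_def)
next
  case (Cons a u)
  let ?N = "\<Sum>r\<in>states G. root_weight S w r"
  have "(\<Sum>r\<in>states G. pmf (trans G q a) r * root_weight S (u @ w) r) \<le>
        (\<Sum>r\<in>states G. pmf (trans G q a) r * (root_weight S u r * ?N))"
    by (intro sum_mono mult_left_mono Cons) auto
  also have "\<dots> = (\<Sum>r\<in>states G. pmf (trans G q a) r * root_weight S u r) * ?N"
    by (subst sum_distrib_right) (simp add: mult.assoc)
  finally have "sqrt (bet G q a) * (\<Sum>r\<in>states G. pmf (trans G q a) r * root_weight S (u @ w) r) \<le>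
        sqrt (bet G q a) * ((\<Sum>r\<in>states G. pmf (trans G q a) r * root_weight S u r) * ?N)"
    using bet_nonneg[OF Cons.prems] by (intro mult_left_mono) auto
  then show ?case by (simp add: indicator_def mult.assoc)
qed

lemma root_weight_normal_decay:
  assumes "bernoulli_normal \<mu> X"
  shows "\<exists>\<theta> C. 0 < \<theta> \<and> \<theta> < 1 \<and>
    (\<forall>n. root_weight active_states (window X 0 n) (init G) \<le> C * \<theta> ^ n)"
proof -
  define N where "N w = (\<Sum>q\<in>states G. root_weight active_states w q)" for w
  obtain k where k: "0 < k" "(\<Sum>q\<in>states G. mean_weight active_states k q) < 1"
    using mean_weight_active_contraction by blast
  have "(\<Sum>w | length w = k. word_measure \<mu> w * N w) = (\<Sum>q\<in>states G. mean_weight active_states k q)"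
    unfolding N_def sum_root_weight[symmetric] by (subst sum.swap) (simp add: sum_distrib_left)
  moreover have "N (u @ w) \<le> N u * N w" for u w
    unfolding N_def sum_distrib_right[of "root_weight active_states u"]
    by (intro sum_mono root_weight_append_le)
  moreover have "0 \<le> N w" for w
    unfolding N_def by (intro sum_nonneg root_weight_nonneg)
  ultimately obtain \<theta> C where *: "0 < \<theta>" "\<theta> < 1" "\<And>n. N (window X 0 n) \<le> C * \<theta> ^ n"
    using submultiplicative_normal_decay[OF assms, of N k] k by auto
  have "root_weight active_states w (init G) \<le> N w" for w
    unfolding N_def using finite_states init_states
    by (intro member_le_sum root_weight_nonneg) auto
  with * show ?thesis by (meson order_trans)
qed

end

subsection \<open>Expectation over random runs\<close>

text \<open>Coordinates range over the whole type, so exceptional choices may lead a run out of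
  \<open>states G\<close>. There are only countably many triples, each with a null exceptional
  set.\<close>

lemma AE_choice_in_set_pmf:
  fixes G :: "('q, 'a::finite) gambler"
  assumes "finite (states G)"
  shows "AE \<omega> in choice_space G. \<forall>n. \<forall>r\<in>states G. \<forall>a. \<omega> (n, r, a) \<in> set_pmf (trans G r a)"
proof -
  have "AE \<omega> in choice_space G. \<omega> (n, r, a) \<in> set_pmf (trans G r a)" if "r \<in> states G" for n r a
  proof -
    have "AE \<omega> in choice_space G. \<omega> (n, r, a) \<in> (case (n, r, a) of (n, r, b) \<Rightarrow> set_pmf (trans G r b))"
      unfolding choice_space_def
      by (rule AE_PiM_component)
         (use that in \<open>auto simp: AE_measure_pmf measure_pmf.prob_space_axioms split: prod.splits\<close>)
    then show ?thesis by simp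
  qed
  then show ?thesis
    using assms by (simp add: AE_all_countable AE_ball_countable countable_finite)
qed

section \<open>Probabilities of finite state paths\<close>

text \<open>The list omits the initial state. Along a fixed path the coordinates consulted are fixed
  and belong to distinct times, so independence applies; along \<open>run\<close> their index is
  itself random.\<close>

definition path_event :: "('q, 'a) gambler \<Rightarrow> (nat \<Rightarrow> 'a) \<Rightarrow> 'q list \<Rightarrow> (nat \<times> 'q \<times> 'a \<Rightarrow> 'q) set" where
  "path_event G X xs =
     {\<omega> \<in> space (choice_space G). \<forall>i<length xs. \<omega> (Suc i, (init G # xs) ! i, X i) = xs ! i}"

lemma path_event_iff_run:
  assumes "\<omega> \<in> space (choice_space G)"
  shows "\<omega> \<in> path_event G X xs \<longleftrightarrow> xs = map (\<lambda>i. run G X \<omega> (Suc i)) [0..<length xs]"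
proof
  assume *: "\<omega> \<in> path_event G X xs"
  have run: "i \<le> length xs \<Longrightarrow> run G X \<omega> i = (init G # xs) ! i" for i
    using * by (induction i) (auto simp: path_event_def)
  show "xs = map (\<lambda>i. run G X \<omega> (Suc i)) [0..<length xs]"
    by (rule nth_equalityI) (use run in \<open>simp_all del: run.simps\<close>)
next
  assume *: "xs = map (\<lambda>i. run G X \<omega> (Suc i)) [0..<length xs]"
  have nth: "xs ! i = run G X \<omega> (Suc i)" if "i < length xs" for i
    using arg_cong[OF *, of "\<lambda>ys. ys ! i"] that by (simp del: run.simps)
  have run: "(init G # xs) ! i = run G X \<omega> i" if "i < length xs" for i
    using nth[of "i - 1"] that by (cases i) auto
  show "\<omega> \<in> path_event G X xs"
    using assms nth run by (simp add: path_event_def)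
qed

context bernoulli_gambler
begin

lemma prob_path_event:
  assumes "set xs \<subseteq> states G"
  shows "path_event G X xs \<in> sets (choice_space G)"
    and "measure (choice_space G) (path_event G X xs) =
           (\<Prod>i<length xs. pmf (trans G ((init G # xs) ! i) (X i)) (xs ! i))"
proof -
  interpret prob_space "choice_space G" by (rule prob_space_choice_space)
  define c where "c i = (Suc i, (init G # xs) ! i, X i)" for i
  define J where "J = c ` {..<length xs}"
  \<comment> \<open>The time component of a coordinate is \<open>Suc i\<close>, from which the
    position in \<open>xs\<close> is recovered.\<close>
  define V where "V j = {xs ! (fst j - 1)}" for j :: "nat \<times> 'q \<times> 'a"
  have st: "(init G # xs) ! i \<in> states G" if "i < length xs" for i
    using assms init_states that by (cases i) auto
  have indep: "indep_vars (\<lambda>_. count_space UNIV) (\<lambda>i \<omega>. \<omega> i) (UNIV \<times> states G \<times> UNIV)"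
    using init_states by (intro indep_vars_choice_space) auto
  have J: "J \<subseteq> UNIV \<times> states G \<times> UNIV" using st by (auto simp: J_def c_def)
  have rv: "(\<lambda>\<omega>. \<omega> j) \<in> measurable (choice_space G) (count_space UNIV)" if "j \<in> J" for j
    using indep J that by (auto simp: indep_vars_def)
  have "path_event G X xs \<in> sets (choice_space G) \<and>
     prob (path_event G X xs) = (\<Prod>i<length xs. pmf (trans G ((init G # xs) ! i) (X i)) (xs ! i))"
  \<comment> \<open>The product rule for independent events is applied to a nonempty index set, so
    the empty path is separate.\<close>
  proof (cases "xs = []")
    case True
    then show ?thesis by (simp add: path_event_def prob_space)
  next
    case False
    have Jne: "J \<noteq> {}" "finite J" using False by (auto simp: J_def)
    have eq: "path_event G X xs = (\<Inter>j\<in>J. (\<lambda>\<omega>. \<omega> j) -` V j \<inter> space (choice_space G))"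
      using Jne(1) by (auto simp: path_event_def J_def c_def V_def)
    have sets: "path_event G X xs \<in> sets (choice_space G)"
      unfolding eq using Jne rv by (intro sets.finite_INT measurable_sets[OF rv]) auto
    have "prob (path_event G X xs) = (\<Prod>j\<in>J. prob ((\<lambda>\<omega>. \<omega> j) -` V j \<inter> space (choice_space G)))"
      unfolding eq by (rule indep_varsD[OF indep Jne J]) simp
    also have "\<dots> = (\<Prod>i<length xs. prob ((\<lambda>\<omega>. \<omega> (c i)) -` V (c i) \<inter> space (choice_space G)))"
      unfolding J_def by (subst prod.reindex) (auto simp: inj_on_def c_def)
    also have "\<dots> = (\<Prod>i<length xs. pmf (trans G ((init G # xs) ! i) (X i)) (xs ! i))"
    proof (rule prod.cong[OF refl])
      fix i assume "i \<in> {..<length xs}"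
      then have i: "i < length xs" by simp
      have "prob ((\<lambda>\<omega>. \<omega> (c i)) -` V (c i) \<inter> space (choice_space G)) =
            measure (distr (choice_space G) (count_space UNIV) (\<lambda>\<omega>. \<omega> (c i))) {xs ! i}"
        using rv[of "c i"] i by (subst measure_distr) (auto simp: J_def V_def c_def)
      also have "\<dots> = pmf (trans G ((init G # xs) ! i) (X i)) (xs ! i)"
        unfolding c_def distr_choice_space[OF st[OF i]] by (simp add: measure_pmf_single)
      finally show "prob ((\<lambda>\<omega>. \<omega> (c i)) -` V (c i) \<inter> space (choice_space G)) =
            pmf (trans G ((init G # xs) ! i) (X i)) (xs ! i)" .
    qed
    finally show ?thesis using sets by blast
  qed
  then show "path_event G X xs \<in> sets (choice_space G)"
    and "prob (path_event G X xs) = (\<Prod>i<length xs. pmf (trans G ((init G # xs) ! i) (X i)) (xs ! i))"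
    by auto
qed

section \<open>Expected square-root capital as a sum over paths\<close>

abbreviation paths :: "nat \<Rightarrow> 'q list set" where
  "paths n \<equiv> {xs. set xs \<subseteq> states G \<and> length xs = n}"

text \<open>There are \<open>n\<close> bets but \<open>n + 1\<close> membership tests: the last
  state is tested too, matching \<open>root_weight S []\<close>.\<close>

definition path_root :: "'q set \<Rightarrow> (nat \<Rightarrow> 'a) \<Rightarrow> (nat \<Rightarrow> 'q) \<Rightarrow> nat \<Rightarrow> real" where
  "path_root S X p n = (\<Prod>i<n. sqrt (bet G (p i) (X i))) * (\<Prod>i\<le>n. indicator S (p i))"

text \<open>This unrolls the recursion; the start \<open>k\<close> and the state \<open>q\<close>
  are general because the induction moves both.\<close>

lemma root_weight_eq_sum_paths:
  "root_weight S (window X k n) q =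
     (\<Sum>xs\<in>paths n. (\<Prod>i<n. pmf (trans G ((q # xs) ! i) (X (k + i))) (xs ! i)) *
        path_root S (\<lambda>i. X (k + i)) (\<lambda>i. (q # xs) ! i) n)"
proof (induction n arbitrary: k q)
  case 0
  have "paths 0 = {[]}" by auto
  then show ?case by (simp add: window_def path_root_def)
next
  case (Suc n)
  have "window X k (Suc n) = X k # window X (Suc k) n"
    using window_append[of X k 1 n] by (simp add: window_def)
  then have "root_weight S (window X k (Suc n)) q = (\<Sum>r\<in>states G.
      indicator S q * sqrt (bet G q (X k)) * pmf (trans G q (X k)) r * root_weight S (window X (Suc k) n) r)"
    by (simp add: sum_distrib_left mult.assoc)
  also have "\<dots> = (\<Sum>r\<in>states G. \<Sum>xs\<in>paths n.
      (\<Prod>i<Suc n. pmf (trans G ((q # r # xs) ! i) (X (k + i))) ((r # xs) ! i)) *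
        path_root S (\<lambda>i. X (k + i)) (\<lambda>i. (q # r # xs) ! i) (Suc n))"
    unfolding Suc.IH sum_distrib_left path_root_def prod.lessThan_Suc_shift prod.atMost_Suc_shift
    by (simp add: mult_ac)
  also have "\<dots> = (\<Sum>xs\<in>paths (Suc n).
      (\<Prod>i<Suc n. pmf (trans G ((q # xs) ! i) (X (k + i))) (xs ! i)) *
        path_root S (\<lambda>i. X (k + i)) (\<lambda>i. (q # xs) ! i) (Suc n))"
    by (rule sum_lists_Suc[OF finite_states, symmetric])
  finally show ?case .
qed

text \<open>A finite combination of event indicators, hence measurable and easy to integrate; it
  stands in for \<open>path_root\<close> along the random run.\<close>

definition path_sum :: "'q set \<Rightarrow> (nat \<Rightarrow> 'a) \<Rightarrow> nat \<Rightarrow> (nat \<times> 'q \<times> 'a \<Rightarrow> 'q) \<Rightarrow> real" where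
  "path_sum S X n \<omega> =
     (\<Sum>xs\<in>paths n. path_root S X (\<lambda>i. (init G # xs) ! i) n * indicator (path_event G X xs) \<omega>)"

lemma path_sum_measurable: "path_sum S X n \<in> borel_measurable (choice_space G)"
  unfolding path_sum_def using prob_path_event(1) by measurable

lemma path_root_nonneg:
  assumes "\<And>i. i < n \<Longrightarrow> p i \<in> states G"
  shows "0 \<le> path_root S X p n"
  unfolding path_root_def using assms by (intro mult_nonneg_nonneg prod_nonneg) (auto simp: bet_nonneg)

lemma path_root_nonneg_paths:
  assumes "xs \<in> paths n"
  shows "0 \<le> path_root S X (\<lambda>i. (init G # xs) ! i) n"
proof (rule path_root_nonneg)
  fix i assume "i < n"
  with assms init_states show "(init G # xs) ! i \<in> states G" by (cases i) auto
qed

lemma path_sum_nonneg: "0 \<le> path_sum S X n \<omega>"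
  unfolding path_sum_def by (intro sum_nonneg mult_nonneg_nonneg path_root_nonneg_paths) auto

lemma nn_integral_path_sum:
  "(\<integral>\<^sup>+\<omega>. ennreal (path_sum S X n \<omega>) \<partial>choice_space G) = ennreal (root_weight S (window X 0 n) (init G))"
proof -
  interpret prob_space "choice_space G" by (rule prob_space_choice_space)
  have int: "integrable (choice_space G) (\<lambda>\<omega>. path_root S X (\<lambda>i. (init G # xs) ! i) n * indicator (path_event G X xs) \<omega>)"
    if "xs \<in> paths n" for xs
    using that prob_path_event(1)[of xs X]
    by (intro integrable_mult_right integrable_real_indicator) (auto simp: emeasure_eq_measure)
  have "integrable (choice_space G) (path_sum S X n)"
    unfolding path_sum_def by (intro Bochner_Integration.integrable_sum int)
  then have "(\<integral>\<^sup>+\<omega>. ennreal (path_sum S X n \<omega>) \<partial>choice_space G) = ennreal (\<integral>\<omega>. path_sum S X n \<omega> \<partial>choice_space G)"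
    by (intro nn_integral_eq_integral) (simp_all add: path_sum_nonneg)
  also have "(\<integral>\<omega>. path_sum S X n \<omega> \<partial>choice_space G) =
      (\<Sum>xs\<in>paths n. path_root S X (\<lambda>i. (init G # xs) ! i) n * prob (path_event G X xs))"
    unfolding path_sum_def
    by (subst Bochner_Integration.integral_sum[OF int])
       (auto intro!: sum.cong simp: prob_path_event(1) sets.Int_space_eq2)
  also have "\<dots> = root_weight S (window X 0 n) (init G)"
    unfolding root_weight_eq_sum_paths
    by (intro sum.cong refl) (auto simp: prob_path_event(2) mult.commute)
  finally show ?thesis .
qed

lemma run_states:
  assumes "\<forall>n. \<forall>r\<in>states G. \<forall>a. \<omega> (n, r, a) \<in> set_pmf (trans G r a)"
  shows "run G X \<omega> n \<in> states G"
proof (induction n)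
  case (Suc n)
  with assms trans_states show ?case by fastforce
qed (simp add: init_states)

text \<open>Exactly one path over \<open>states G\<close> has its event occur, namely that of the
  actual run.\<close>

lemma path_sum_eq:
  assumes \<omega>: "\<omega> \<in> space (choice_space G)"
    and "\<forall>n. \<forall>r\<in>states G. \<forall>a. \<omega> (n, r, a) \<in> set_pmf (trans G r a)"
  shows "path_sum S X n \<omega> = path_root S X (run G X \<omega>) n"
proof -
  define ys where "ys = map (\<lambda>i. run G X \<omega> (Suc i)) [0..<n]"
  have ys: "ys \<in> paths n"
    using run_states[OF assms(2)] by (auto simp: ys_def simp del: run.simps)
  have fin: "finite (paths n)" by (rule finite_lists_length_eq[OF finite_states])
  have "path_sum S X n \<omega> =
      (\<Sum>xs\<in>paths n. if xs = ys then path_root S X (\<lambda>i. (init G # ys) ! i) n else 0)"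
    unfolding path_sum_def
    by (intro sum.cong refl) (auto simp: path_event_iff_run[OF \<omega>] ys_def indicator_def simp del: run.simps)
  also have "\<dots> = path_root S X (\<lambda>i. (init G # ys) ! i) n"
    using ys fin by (simp add: sum.delta')
  also have "\<dots> = path_root S X (run G X \<omega>) n"
  proof -
    have "(init G # ys) ! i = run G X \<omega> i" if "i \<le> n" for i
      using that by (cases i) (auto simp: ys_def simp del: run.simps(2))
    then show ?thesis
      unfolding path_root_def by (intro arg_cong2[of _ _ _ _ "(*)"] prod.cong) auto
  qed
  finally show ?thesis .
qed

section \<open>The two behaviours of the capital along a single run\<close>

lemma capital_eventually_constant:
  assumes run: "\<forall>n. \<forall>r\<in>states G. \<forall>a. \<omega> (n, r, a) \<in> set_pmf (trans G r a)"
    and m: "run G X \<omega> m \<in> constant_states"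
  shows "ultimately_constant (capital G X \<omega>)"
proof -
  have absorbed: "run G X \<omega> (m + k) \<in> constant_states" for k
  proof (induction k)
    case (Suc k)
    with run constant_states_trans constant_states_def show ?case by fastforce
  qed (simp add: m)
  have "capital G X \<omega> (m + k) = capital G X \<omega> m" for k
  proof (induction k)
    case (Suc k)
    then show ?case
      using constant_states_bet[OF absorbed[of "Suc k"]] by (simp add: capital_def del: run.simps)
  qed simp
  then have "capital G X \<omega> n = capital G X \<omega> m" if "n \<ge> m" for n
    using le_Suc_ex[OF that] by auto
  then show ?thesis
    unfolding ultimately_constant_def eventually_sequentially by blast
qed

text \<open>The indicators are all \<open>1\<close> on such a run, so squaring the bound gives the
  rate \<open>- (2 * log 2 \<theta>)\<close>.\<close>

lemma capital_decreases_exponentially: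
  assumes run: "\<forall>n. run G X \<omega> n \<in> active_states"
    and \<theta>: "0 < \<theta>" "\<theta> < 1" and decay: "\<forall>\<^sub>F n in sequentially. path_root active_states X (run G X \<omega>) n \<le> \<theta> ^ n"
  shows "decreases_exponentially (capital G X \<omega>)"
proof -
  \<comment> \<open>The index shifts because \<open>capital\<close> at \<open>n\<close> already
    includes the bet on letter \<open>n\<close>.\<close>
  have root: "path_root active_states X (run G X \<omega>) (Suc n) = sqrt (capital G X \<omega> n)" for n
  proof -
    have "(\<Prod>i\<le>Suc n. indicator active_states (run G X \<omega> i)) = (1 :: real)"
      using run by (intro prod.neutral) auto
    moreover have "(\<Prod>i<Suc n. sqrt (bet G (run G X \<omega> i) (X i))) = sqrt (capital G X \<omega> n)"
      by (induction n) (simp_all add: capital_def real_sqrt_mult del: run.simps)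
    ultimately show ?thesis by (simp only: path_root_def mult_1_right)
  qed
  have "\<forall>\<^sub>F n in sequentially. sqrt (capital G X \<omega> n) \<le> \<theta> ^ Suc n"
    using eventually_sequentially_Suc[THEN iffD2, OF decay] by (simp only: root)
  then have "\<forall>\<^sub>F n in sequentially. capital G X \<omega> n \<le> 2 powr (- (- (2 * log 2 \<theta>)) * real n)"
  proof eventually_elim
    case (elim n)
    have "\<theta> ^ Suc n \<le> \<theta> ^ n" using \<theta> by (intro power_decreasing) auto
    with elim have "sqrt (capital G X \<omega> n) \<le> \<theta> ^ n" by linarith
    then have "capital G X \<omega> n \<le> (\<theta> ^ n)\<^sup>2" by (rule sqrt_le_D)
    also have "\<theta> ^ n = 2 powr (log 2 \<theta> * real n)"
      using \<theta> by (simp add: powr_powr[symmetric] powr_realpow)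
    finally show ?case
      by (simp add: power2_eq_square powr_add[symmetric] algebra_simps)
  qed
  moreover have "- (2 * log 2 \<theta>) > 0" using \<theta> by simp
  ultimately show ?thesis unfolding decreases_exponentially_def by blast
qed

theorem normal_capital_dichotomy:
  assumes "bernoulli_normal \<mu> X"
  shows "AE \<omega> in choice_space G.
    ultimately_constant (capital G X \<omega>) \<or> decreases_exponentially (capital G X \<omega>)"
proof -
  obtain \<theta> C where \<theta>: "0 < \<theta>" "\<theta> < 1"
    and C: "\<And>n. root_weight active_states (window X 0 n) (init G) \<le> C * \<theta> ^ n"
    using root_weight_normal_decay[OF assms] by blast
  \<comment> \<open>Half of the exponential decay is spent on normalising by
    \<open>\<eta> ^ n\<close>; the other half keeps the expectations summable.\<close>
  define \<eta> where "\<eta> = sqrt \<theta>"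
  have \<eta>: "0 < \<eta>" "\<eta> < 1" "\<theta> = \<eta> * \<eta>" using \<theta> by (auto simp: \<eta>_def)
  define Z where "Z n \<omega> = path_sum active_states X n \<omega> / \<eta> ^ n" for n \<omega>
  have Z0: "0 \<le> Z n \<omega>" for n \<omega> using path_sum_nonneg \<eta> by (simp add: Z_def)
  have Zm: "Z n \<in> borel_measurable (choice_space G)" for n
    unfolding Z_def using path_sum_measurable by measurable
  have Zint: "(\<integral>\<^sup>+\<omega>. ennreal (Z n \<omega>) \<partial>choice_space G) \<le> ennreal (C * \<eta> ^ n)" for n
  proof -
    have "(\<integral>\<^sup>+\<omega>. ennreal (Z n \<omega>) \<partial>choice_space G) =
        (\<integral>\<^sup>+\<omega>. ennreal (1 / \<eta> ^ n) * ennreal (path_sum active_states X n \<omega>) \<partial>choice_space G)"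
      using \<eta> by (intro nn_integral_cong) (simp add: Z_def ennreal_mult'[symmetric])
    also have "\<dots> = ennreal (1 / \<eta> ^ n) * ennreal (root_weight active_states (window X 0 n) (init G))"
      using path_sum_measurable
      by (subst nn_integral_cmult) (simp_all add: nn_integral_path_sum)
    also have "\<dots> = ennreal (1 / \<eta> ^ n * root_weight active_states (window X 0 n) (init G))"
      using \<eta> by (intro ennreal_mult'[symmetric]) simp
    also have "\<dots> \<le> ennreal (1 / \<eta> ^ n * (C * \<theta> ^ n))"
      using C \<eta> by (intro ennreal_leI mult_left_mono) auto
    also have "1 / \<eta> ^ n * (C * \<theta> ^ n) = C * \<eta> ^ n"
      using \<eta> by (simp add: power_mult_distrib)
    finally show ?thesis .
  qed
  have "C \<ge> 0"
    using C[of 0] root_weight_nonneg[OF init_states, of active_states "window X 0 0"] by simp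
  \<comment> \<open>The series of all \<open>Z n\<close> has finite expectation, so it converges
    almost surely and its terms are eventually below \<open>1\<close>.\<close>
  have "(\<integral>\<^sup>+\<omega>. (\<Sum>n. ennreal (Z n \<omega>)) \<partial>choice_space G) = (\<Sum>n. \<integral>\<^sup>+\<omega>. ennreal (Z n \<omega>) \<partial>choice_space G)"
    using Zm by (intro nn_integral_suminf) measurable
  also have "\<dots> \<le> (\<Sum>n. ennreal (C * \<eta> ^ n))"
    by (intro suminf_le Zint) auto
  also have "\<dots> < \<infinity>"
  proof -
    have "summable (\<lambda>n. C * \<eta> ^ n)"
      using \<eta> by (intro summable_mult summable_geometric) simp
    then have "(\<Sum>n. ennreal (C * \<eta> ^ n)) \<noteq> top"
      by (rule ennreal_suminf_neq_top) (use \<eta> \<open>C \<ge> 0\<close> in simp)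
    then show ?thesis unfolding infinity_ennreal_def by (simp only: top.not_eq_extremum)
  qed
  finally have "(\<integral>\<^sup>+\<omega>. (\<Sum>n. ennreal (Z n \<omega>)) \<partial>choice_space G) \<noteq> \<infinity>"
    by (rule less_imp_neq)
  then have "AE \<omega> in choice_space G. (\<Sum>n. ennreal (Z n \<omega>)) \<noteq> \<infinity>"
    by (rule nn_integral_PInf_AE[rotated]) (use Zm in measurable)
  then show ?thesis
    using AE_choice_in_set_pmf[OF finite_states] AE_space
  proof eventually_elim
    case (elim \<omega>)
    show ?case
    proof (cases "\<forall>n. run G X \<omega> n \<in> active_states")
      case False
      then obtain m where "run G X \<omega> m \<in> constant_states"
        using run_states[OF elim(2)] by blast
      then show ?thesis using capital_eventually_constant[OF elim(2)] by blast
    next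
      case True
      have "summable (\<lambda>n. Z n \<omega>)"
        using Z0 elim(1) by (intro summable_suminf_not_top) auto
      then have "\<forall>\<^sub>F n in sequentially. Z n \<omega> < 1"
        using order_tendstoD(2)[OF summable_LIMSEQ_zero, of "\<lambda>n. Z n \<omega>" 1] by simp
      then have "\<forall>\<^sub>F n in sequentially. path_root active_states X (run G X \<omega>) n \<le> \<eta> ^ n"
        by eventually_elim (use \<eta> in \<open>simp add: Z_def path_sum_eq[OF elim(3,2)] field_simps\<close>)
      then show ?thesis
        using capital_decreases_exponentially[OF True \<eta>(1,2)] by blast
    qed
  qed
qed

end

subsection \<open>Betting on a word of incorrect frequency\<close>

definition last_letters :: "nat \<Rightarrow> 'a list \<Rightarrow> 'a list" where
  "last_letters m l = drop (length l - m) l"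

lemma length_last_letters: "length (last_letters m l) = min m (length l)"
  by (simp add: last_letters_def)

text \<open>The memory can be updated from its own content and the new letter, so finitely many
  states suffice.\<close>

lemma last_letters_snoc: "last_letters m (last_letters m l @ [b]) = last_letters m (l @ [b])"
  by (cases "length l \<le> m") (auto simp: last_letters_def Suc_diff_le)

text \<open>States are words coded by \<open>to_nat\<close>; the shorter words serve until
  \<open>length v\<close> letters have been read. Transitions are point masses.\<close>

definition word_gambler :: "('a::finite \<Rightarrow> real) \<Rightarrow> 'a list \<Rightarrow> 'a \<Rightarrow> real \<Rightarrow> (nat, 'a) gambler" where
  "word_gambler \<mu> v a t = \<lparr>states = to_nat ` {w :: 'a list. length w \<le> length v}, init = to_nat ([] :: 'a list),
     trans = (\<lambda>q b. return_pmf (to_nat (last_letters (length v) (from_nat q @ [b])))),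
     bet = (\<lambda>q b. if q = to_nat v then 1 + t * (of_bool (b = a) - \<mu> a) else 1)\<rparr>"

lemma sum_bernoulli_tilt:
  assumes "positive_bernoulli \<mu>"
  shows "(\<Sum>b\<in>UNIV. \<mu> b * (1 + t * (of_bool (b = a) - \<mu> a))) = 1"
proof -
  have "\<mu> b * (1 + t * (of_bool (b = a) - \<mu> a)) = \<mu> b - t * \<mu> a * \<mu> b + (if b = a then t * \<mu> b else 0)" for b
    by (auto simp: algebra_simps)
  then show ?thesis
    using assms by (simp add: sum.distrib sum_subtractf sum_distrib_left[symmetric] positive_bernoulli_def)
qed

lemma tilt_bound:
  assumes "positive_bernoulli \<mu>"
  shows "\<bar>t * (of_bool (b = a) - \<mu> a)\<bar> \<le> \<bar>t\<bar>"
proof -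
  have "0 < \<mu> a" "\<mu> a \<le> 1" using assms by (auto simp: positive_bernoulli_def)
  then have "\<bar>of_bool (b = a) - \<mu> a\<bar> \<le> 1" by (cases "b = a") auto
  then show ?thesis using mult_left_mono[of _ 1 "\<bar>t\<bar>"] by (simp add: abs_mult)
qed

lemma prob_gambler_word_gambler:
  assumes "positive_bernoulli \<mu>" "\<bar>t\<bar> \<le> 1 / 2"
  shows "prob_gambler \<mu> (word_gambler \<mu> v a t)"
proof -
  let ?G = "word_gambler \<mu> v a t"
  have "0 \<le> 1 + t * (of_bool (b = a) - \<mu> a)" for b
    using tilt_bound[OF assms(1), of t b a] assms(2) by linarith
  then have "0 \<le> bet ?G q b" for q b
    by (simp add: word_gambler_def)
  moreover have "(\<Sum>b\<in>UNIV. \<mu> b * bet ?G q b) = 1" for q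
    using sum_bernoulli_tilt[OF assms(1), of t a] assms(1)
    by (cases "q = to_nat v") (simp_all add: word_gambler_def positive_bernoulli_def)
  moreover have "finite (states ?G)"
    using finite_lists_length_le[of "UNIV :: 'a set"] by (simp add: word_gambler_def)
  moreover have "init ?G \<in> states ?G" and "set_pmf (trans ?G q b) \<subseteq> states ?G" for q b
    by (simp_all add: word_gambler_def length_last_letters)
  ultimately show ?thesis
    unfolding prob_gambler_def by blast
qed

text \<open>Although the transitions are point masses, a choice \<open>\<omega>\<close> follows them
  only almost surely, hence the support hypothesis.\<close>

lemma run_word_gambler:
  fixes \<mu> :: "'a::finite \<Rightarrow> real"
  assumes "\<forall>n. \<forall>r\<in>states (word_gambler \<mu> v a t). \<forall>b. \<omega> (n, r, b) \<in> set_pmf (trans (word_gambler \<mu> v a t) r b)"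
  shows "run (word_gambler \<mu> v a t) X \<omega> n = to_nat (last_letters (length v) (window X 0 n))"
proof (induction n)
  case 0
  then show ?case by (simp add: word_gambler_def last_letters_def window_def)
next
  case (Suc n)
  let ?l = "last_letters (length v) (window X 0 n)"
  have "to_nat ?l \<in> states (word_gambler \<mu> v a t)"
    by (simp add: word_gambler_def length_last_letters)
  with assms have "\<omega> (Suc n, to_nat ?l, X n) \<in> set_pmf (trans (word_gambler \<mu> v a t) (to_nat ?l) (X n))"
    by blast
  then have "\<omega> (Suc n, to_nat ?l, X n) = to_nat (last_letters (length v) (?l @ [X n]))"
    by (simp add: word_gambler_def)
  also have "\<dots> = to_nat (last_letters (length v) (window X 0 (Suc n)))"
    by (simp add: last_letters_snoc window_def)
  finally show ?case by (simp add: Suc)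
qed

lemma last_letters_window:
  "last_letters m (window X 0 (m + j)) = window X j m"
  using window_append[of X 0 j m] by (simp add: last_letters_def add.commute)

section \<open>Logarithmic growth of the capital\<close>

text \<open>Indexed by the start \<open>j\<close> of the window, so the bet in question falls on
  position \<open>j + length v\<close>.\<close>

definition tilt :: "('a \<Rightarrow> real) \<Rightarrow> 'a list \<Rightarrow> 'a \<Rightarrow> real \<Rightarrow> (nat \<Rightarrow> 'a) \<Rightarrow> nat \<Rightarrow> real" where
  "tilt \<mu> v a t X j =
     (if window X j (length v) = v then 1 + t * (of_bool (X (j + length v) = a) - \<mu> a) else 1)"

text \<open>During the first \<open>length v\<close> letters the memory is shorter than
  \<open>v\<close>, so those bets are all \<open>1\<close>.\<close>

lemma prod_bet_word_gambler:
  fixes \<mu> :: "'a::finite \<Rightarrow> real"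
  assumes "\<And>n. run (word_gambler \<mu> v a t) X \<omega> n = to_nat (last_letters (length v) (window X 0 n))"
  shows "(\<Prod>i<length v + k. bet (word_gambler \<mu> v a t) (run (word_gambler \<mu> v a t) X \<omega> i) (X i)) =
    (\<Prod>j<k. tilt \<mu> v a t X j)"
proof (induction k)
  case 0
  have "last_letters (length v) (window X 0 i) \<noteq> v" if "i < length v" for i
    using that length_last_letters[of "length v" "window X 0 i"] by auto
  then show ?case
    unfolding assms by (intro trans[OF prod.neutral]) (auto simp: word_gambler_def)
next
  case (Suc k)
  then show ?case
    by (simp add: assms last_letters_window) (simp add: word_gambler_def tilt_def add.commute)
qed

text \<open>Second-order estimate of \<open>ln (1 + x)\<close> with \<bar>x\<bar> at most
  \<bar>t\<bar>. The linear part is written with occurrences of \<open>v @ [a]\<close> and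
  \<open>v\<close>, so that summation yields counts.\<close>

lemma ln_tilt_lower_bound:
  assumes "positive_bernoulli \<mu>" "\<bar>t\<bar> \<le> 1 / 2"
  shows "0 < tilt \<mu> v a t X j"
    and "t * (of_bool (window X j (Suc (length v)) = v @ [a]) - \<mu> a * of_bool (window X j (length v) = v))
      - 2 * t\<^sup>2 \<le> ln (tilt \<mu> v a t X j)"
proof -
  let ?x = "t * (of_bool (X (j + length v) = a) - \<mu> a)"
  have x: "\<bar>?x\<bar> \<le> \<bar>t\<bar>" by (rule tilt_bound[OF assms(1)])
  with assms(2) show "0 < tilt \<mu> v a t X j" by (auto simp: tilt_def)
  have win: "window X j (Suc (length v)) = window X j (length v) @ [X (j + length v)]"
    by (simp add: window_def)
  have "\<bar>ln (1 + ?x) - ?x\<bar> \<le> 2 * ?x\<^sup>2"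
    using x assms(2) by (intro abs_ln_one_plus_x_minus_x_bound) linarith
  moreover have "?x\<^sup>2 \<le> t\<^sup>2" using x by (simp only: abs_le_square_iff)
  ultimately have "?x - 2 * t\<^sup>2 \<le> ln (1 + ?x)" by linarith
  then show "t * (of_bool (window X j (Suc (length v)) = v @ [a]) - \<mu> a * of_bool (window X j (length v) = v))
      - 2 * t\<^sup>2 \<le> ln (tilt \<mu> v a t X j)"
    unfolding win tilt_def by (cases "window X j (length v) = v") auto
qed

lemma capital_word_gambler_lower_bound:
  fixes \<mu> :: "'a::finite \<Rightarrow> real"
  assumes "positive_bernoulli \<mu>" "\<bar>t\<bar> \<le> 1 / 2"
    and run: "\<And>n. run (word_gambler \<mu> v a t) X \<omega> n = to_nat (last_letters (length v) (window X 0 n))"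
    and n: "Suc n = length v + k"
  shows "0 < capital (word_gambler \<mu> v a t) X \<omega> n"
    and "t * ((\<Sum>j<k. of_bool (window X j (length (v @ [a])) = v @ [a]))
           - \<mu> a * (\<Sum>j<k. of_bool (window X j (length v) = v))) - 2 * t\<^sup>2 * real k
         \<le> ln (capital (word_gambler \<mu> v a t) X \<omega> n)"
proof -
  note g = ln_tilt_lower_bound[OF assms(1,2), where v = v and a = a and X = X]
  have "capital (word_gambler \<mu> v a t) X \<omega> n =
      (\<Prod>i<length v + k. bet (word_gambler \<mu> v a t) (run (word_gambler \<mu> v a t) X \<omega> i) (X i))"
    unfolding capital_def n[symmetric] by (simp only: lessThan_Suc_atMost atMost_atLeast0)
  also have "\<dots> = (\<Prod>j<k. tilt \<mu> v a t X j)" by (rule prod_bet_word_gambler[OF run])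
  finally have cap: "capital (word_gambler \<mu> v a t) X \<omega> n = (\<Prod>j<k. tilt \<mu> v a t X j)" .
  show "0 < capital (word_gambler \<mu> v a t) X \<omega> n"
    unfolding cap by (intro prod_pos ballI g(1))
  have "t * ((\<Sum>j<k. of_bool (window X j (length (v @ [a])) = v @ [a]))
           - \<mu> a * (\<Sum>j<k. of_bool (window X j (length v) = v))) - 2 * t\<^sup>2 * real k =
    (\<Sum>j<k. t * (of_bool (window X j (Suc (length v)) = v @ [a]) - \<mu> a * of_bool (window X j (length v) = v))
      - 2 * t\<^sup>2)"
    by (simp add: sum_subtractf sum_distrib_left right_diff_distrib
        del: sum_of_bool_eq sum_mult_of_bool_eq sum_of_bool_mult_eq)
  also have "\<dots> \<le> (\<Sum>j<k. ln (tilt \<mu> v a t X j))" by (intro sum_mono g(2))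
  also have "\<dots> = ln (\<Prod>j<k. tilt \<mu> v a t X j)" by (intro ln_prod[symmetric] less_imp_neq[OF g(1), symmetric] finite_lessThan)
  finally show "t * ((\<Sum>j<k. of_bool (window X j (length (v @ [a])) = v @ [a]))
           - \<mu> a * (\<Sum>j<k. of_bool (window X j (length v) = v))) - 2 * t\<^sup>2 * real k
         \<le> ln (capital (word_gambler \<mu> v a t) X \<omega> n)"
    unfolding cap .
qed

lemma limsup_elog_pos:
  assumes "\<exists>\<^sub>F n in sequentially. 0 < c n \<and> d * real n \<le> ln (c n)" and "d > 0"
  shows "limsup (\<lambda>n. elog (c n) / ereal (real n)) > 0"
proof (rule ccontr)
  \<comment> \<open>Dividing by \<open>ln 2\<close> converts the natural rate \<open>d\<close> to
    base two.\<close>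
  define d' where "d' = d / ln 2"
  have "d' > 0" using assms(2) by (simp add: d'_def)
  assume "\<not> limsup (\<lambda>n. elog (c n) / ereal (real n)) > 0"
  then have "limsup (\<lambda>n. elog (c n) / ereal (real n)) < ereal d'"
    using \<open>d' > 0\<close> by (simp add: not_less order.strict_trans1)
  then have "\<forall>\<^sub>F n in sequentially. elog (c n) / ereal (real n) < ereal d'"
    by (rule Limsup_lessD)
  then have "\<forall>\<^sub>F n in sequentially. \<not> (0 < c n \<and> d * real n \<le> ln (c n))"
    using eventually_gt_at_top[of 0]
  proof eventually_elim
    case (elim n)
    show ?case
    proof
      assume c: "0 < c n \<and> d * real n \<le> ln (c n)"
      then have "ereal (log 2 (c n) / real n) < ereal d'"
        using elim by (simp add: elog_def)
      then have "ln (c n) < d * real n"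
        using elim(2) by (simp add: d'_def log_def field_simps)
      with c show False by linarith
    qed
  qed
  with assms(1) show False by (simp add: frequently_def)
qed

section \<open>Choosing the word and the size of the bet\<close>

text \<open>The sign \<open>s\<close> later decides whether to bet on the letter or against
  it.\<close>

lemma not_tendsto_real_cases:
  fixes f :: "nat \<Rightarrow> real"
  assumes "\<not> f \<longlonglongrightarrow> l"
  obtains e s where "e > 0" "\<bar>s\<bar> = 1" "\<exists>\<^sub>F n in sequentially. s * (f n - l) \<ge> e"
proof -
  obtain e where e: "e > 0" "\<exists>\<^sub>F n in sequentially. \<bar>f n - l\<bar> \<ge> e"
    using assms by (auto simp: tendsto_iff dist_real_def frequently_def not_le)
  have "(\<exists>\<^sub>F n in sequentially. f n - l \<ge> e \<or> - (f n - l) \<ge> e)"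
    using e(2) by (rule frequently_mono[rotated]) (auto simp: abs_if split: if_splits)
  then consider "\<exists>\<^sub>F n in sequentially. f n - l \<ge> e" | "\<exists>\<^sub>F n in sequentially. - (f n - l) \<ge> e"
    by (auto simp: frequently_disj_iff)
  then show thesis
    using that[of e 1] that[of e "-1"] e(1) by cases auto
qed

text \<open>Otherwise correct frequencies would spread from the empty word, of frequency
  \<open>1\<close>, to all words by appending letters.\<close>

lemma not_normal_minimal_word:
  assumes "\<not> bernoulli_normal \<mu> X"
  obtains v a where "(\<lambda>n. freq v (upto_pos X n)) \<longlonglongrightarrow> word_measure \<mu> v"
    "\<not> (\<lambda>n. freq (v @ [a]) (upto_pos X n)) \<longlonglongrightarrow> word_measure \<mu> (v @ [a])"
proof -
  let ?N = "\<lambda>w. (\<lambda>n. freq w (upto_pos X n)) \<longlonglongrightarrow> word_measure \<mu> w"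
  have "\<exists>v a. ?N v \<and> \<not> ?N (v @ [a])"
  proof (rule ccontr)
    assume *: "\<not> ?thesis"
    have "?N w" for w
    proof (induction w rule: rev_induct)
      case Nil
      have "freq [] (upto_pos X n) = 1" for n by (simp add: freq_upto_pos window_def)
      then show ?case by (simp add: word_measure_def)
    next
      case (snoc a v)
      with * show ?case by blast
    qed
    with assms show False by (simp add: bernoulli_normal_def)
  qed
  with that show thesis by blast
qed

theorem not_normal_winning_gambler:
  fixes \<mu> :: "'a::finite \<Rightarrow> real"
  assumes bern: "positive_bernoulli \<mu>" and "\<not> bernoulli_normal \<mu> X"
  shows "\<exists>G :: (nat, 'a) gambler. prob_gambler \<mu> G \<and>
    (AE \<omega> in choice_space G. limsup (\<lambda>n. elog (capital G X \<omega> n) / ereal (real n)) > 0)"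
proof -
  obtain v a where v: "(\<lambda>n. freq v (upto_pos X n)) \<longlonglongrightarrow> word_measure \<mu> v"
    and va: "\<not> (\<lambda>n. freq (v @ [a]) (upto_pos X n)) \<longlonglongrightarrow> word_measure \<mu> (v @ [a])"
    using not_normal_minimal_word[OF assms(2)] by blast
  define m where "m = length v"
  define V where "V k = (\<Sum>j<k. of_bool (window X j (length v) = v) :: real)" for k
  define A where "A k = (\<Sum>j<k. of_bool (window X j (length (v @ [a])) = v @ [a]) :: real)" for k
  have V: "(\<lambda>k. V k / real k) \<longlonglongrightarrow> word_measure \<mu> v"
    using v unfolding freq_tendsto_iff_window V_def .
  have A: "\<not> (\<lambda>k. A k / real k) \<longlonglongrightarrow> \<mu> a * word_measure \<mu> v"
    using va unfolding freq_tendsto_iff_window A_def by (simp add: word_measure_def mult.commute del: sum_of_bool_eq)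
  \<comment> \<open>As \<open>V k / real k\<close> converges, convergence of this difference to
    \<open>0\<close> would give \<open>A k / real k\<close> the correct limit.\<close>
  have "\<not> (\<lambda>k. A k / real k - \<mu> a * (V k / real k)) \<longlonglongrightarrow> 0"
  proof
    assume "(\<lambda>k. A k / real k - \<mu> a * (V k / real k)) \<longlonglongrightarrow> 0"
    from tendsto_add[OF this tendsto_mult_left[OF V, of "\<mu> a"]] A show False by simp
  qed
  then obtain e s where e: "e > 0" "\<bar>s\<bar> = 1"
    and freqs: "\<exists>\<^sub>F k in sequentially. s * (A k / real k - \<mu> a * (V k / real k) - 0) \<ge> e"
    by (rule not_tendsto_real_cases)
  \<comment> \<open>The bound \<open>1 / 2\<close> keeps the bets positive; \<open>e / 4\<close>
    keeps the quadratic loss \<open>2 * \<eta>\<^sup>2\<close> within half of the linear gain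
    \<open>\<eta> * e\<close>.\<close>
  define \<eta> where "\<eta> = min (1 / 2) (e / 4)"
  define t where "t = s * \<eta>"
  have \<eta>: "0 < \<eta>" "\<eta> \<le> 1 / 2" "4 * \<eta> \<le> e" using e by (auto simp: \<eta>_def)
  have t: "\<bar>t\<bar> \<le> 1 / 2" "t\<^sup>2 = \<eta>\<^sup>2"
    using e \<eta> by (auto simp: t_def abs_mult power_mult_distrib abs_square_eq_1)
  \<comment> \<open>The remaining gain per window is \<open>\<eta> * e / 2 = 2 * d\<close>; the
    factor two will absorb the passage from \<open>k\<close> to \<open>n\<close>.\<close>
  define d where "d = \<eta> * e / 4"
  have d: "d > 0" using \<eta> e by (simp add: d_def)
  have grow: "2 * d * real k \<le> t * (A k - \<mu> a * V k) - 2 * t\<^sup>2 * real k"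
    if "s * (A k / real k - \<mu> a * (V k / real k) - 0) \<ge> e" "k > 0" for k
  proof -
    have "e * real k \<le> s * (A k - \<mu> a * V k)"
      using that by (simp add: field_simps)
    then have "\<eta> * (e * real k) \<le> \<eta> * (s * (A k - \<mu> a * V k))"
      using \<eta> by (intro mult_left_mono) auto
    moreover have "\<eta> * (4 * \<eta>) * real k \<le> \<eta> * e * real k"
      using \<eta> by (intro mult_right_mono mult_left_mono) auto
    ultimately show ?thesis
      unfolding t(2) by (simp add: d_def t_def power2_eq_square algebra_simps)
  qed
  let ?G = "word_gambler \<mu> v a t"
  have gambler: "prob_gambler \<mu> ?G" by (rule prob_gambler_word_gambler[OF bern t(1)])
  then have "finite (states ?G)" by (simp add: prob_gambler_def)
  note choices = AE_choice_in_set_pmf[OF this]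
  have "AE \<omega> in choice_space ?G. limsup (\<lambda>n. elog (capital ?G X \<omega> n) / ereal (real n)) > 0"
    using choices
  proof eventually_elim
    case (elim \<omega>)
    note run = run_word_gambler[OF elim, where X = X]
    have "\<exists>\<^sub>F n in sequentially. 0 < capital ?G X \<omega> n \<and> d * real n \<le> ln (capital ?G X \<omega> n)"
      unfolding frequently_sequentially
    proof
      fix N
      \<comment> \<open>The margin \<open>N + m\<close> ensures both that \<open>n\<close> is at
        least \<open>N\<close> and that \<open>n\<close> is at most \<open>2 * k\<close>.\<close>
      obtain k where k: "k \<ge> Suc (N + m)" "s * (A k / real k - \<mu> a * (V k / real k) - 0) \<ge> e"
        using freqs unfolding frequently_sequentially by blast
      define n where "n = m + k - 1"
      have n: "Suc n = length v + k" using k(1) by (simp add: n_def m_def)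
      note cap = capital_word_gambler_lower_bound[OF bern t(1) run n]
      have "d * real n \<le> d * (2 * real k)"
        using k(1) d by (intro mult_left_mono) (auto simp: n_def)
      also have "\<dots> \<le> ln (capital ?G X \<omega> n)"
        using order_trans[OF grow[OF k(2), unfolded A_def V_def] cap(2)] k(1)
        by (simp only: mult_ac)
      finally show "\<exists>n\<ge>N. 0 < capital ?G X \<omega> n \<and> d * real n \<le> ln (capital ?G X \<omega> n)"
        using cap(1) k(1) by (intro exI[of _ n]) (auto simp: n_def)
    qed
    then show ?case using d by (rule limsup_elog_pos)
  qed
  with gambler show ?thesis by blast
qed

theorem theorem4p2:
  fixes \<mu> :: "'a::finite \<Rightarrow> real" and X :: "nat \<Rightarrow> 'a"
  assumes "positive_bernoulli \<mu>"
  shows "(bernoulli_normal \<mu> X \<longrightarrow>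
            (\<forall>G :: ('q, 'a) gambler. prob_gambler \<mu> G \<longrightarrow>
               (AE \<omega> in choice_space G.
                  ultimately_constant (capital G X \<omega>) \<or>
                  decreases_exponentially (capital G X \<omega>)))) \<and>
         (\<not> bernoulli_normal \<mu> X \<longrightarrow>
            (\<exists>G :: (nat, 'a) gambler. prob_gambler \<mu> G \<and>
               (AE \<omega> in choice_space G.
                  limsup (\<lambda>n. elog (capital G X \<omega> n) / ereal (real n)) > 0)))"
  using assms bernoulli_gambler.normal_capital_dichotomy[OF bernoulli_gambler.intro]
    not_normal_winning_gambler by blast

end
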